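(* The 9-dimensional Cohn-Elkies linear programming bound (i.e., the Cohn-Elkies linear programming bound in $\mathbb{R}^9$) is greater than or equal to $\frac{1}{20}=0.05$.
   Context: Fourier transform on $\mathbb{R}^d$: $\widehat f(y)=\int_{\mathbb{R}^d} f(x)e^{-2\pi i\langle x,y\rangle}\,dx$, where $\langle x,y\rangle=x_1y_1+\cdots+x_dy_d$. A function $f:\mathbb{R}^d\to\mathbb{R}$ is rapidly decreasing if $f(x)=O\left((1+|x|)^{-k}\right)$ for all positive integers $k$; it is radial if $f(x)$ depends only on $|x|$. For fixed $r>0$ and positive integer $d$, the Cohn-Elkies linear programming bound in $\mathbb{R}^d$ is the infimum of $\left(\frac r2\right)^d f(0)$ over all radial, smooth, rapidly decreasing functions $f:\mathbb{R}^d\to\mathbb{R}$ such that $f(0)>0$; $\widehat f(0)\geq 1$; $f(x)\leq 0$ for all $|x|\geq r$; and $\widehat f(y)\geq 0$ for all $y\in\mathbb{R}^d$. This value does not depend on $r$ (by rescaling $f$). *)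

theory Defs
  imports "HOL-Analysis.Analysis"
begin

definition fourier_transform :: "(real ^ 'd \<Rightarrow> real) \<Rightarrow> real ^ 'd \<Rightarrow> complex" where
  "fourier_transform f y =
     (LINT x|lborel. complex_of_real (f x) * exp (- 2 * of_real pi * \<i> * of_real (x \<bullet> y)))"

definition rapidly_decreasing :: "(real ^ 'd \<Rightarrow> real) \<Rightarrow> bool" where
  "rapidly_decreasing f \<longleftrightarrow>
     (\<forall>k::nat. k > 0 \<longrightarrow> (\<exists>C. \<forall>x. \<bar>f x\<bar> \<le> C * inverse ((1 + norm x) ^ k)))"

definition radial :: "(real ^ 'd \<Rightarrow> real) \<Rightarrow> bool" where
  "radial f \<longleftrightarrow> (\<forall>x y. norm x = norm y \<longrightarrow> f x = f y)"

text \<open>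
  Class \<open>C\<^sup>n\<close> on the whole space: \<open>f\<close> is (Frechet) differentiable everywhere and, for every
  direction \<open>v\<close>, the directional derivative of \<open>f\<close> along \<open>v\<close> is of class \<open>C\<^sup>n\<^sup>-\<^sup>1\<close>.
\<close>
primrec C_class :: "nat \<Rightarrow> (real ^ 'd \<Rightarrow> real) \<Rightarrow> bool" where
  "C_class 0 f \<longleftrightarrow> continuous_on UNIV f"
| "C_class (Suc n) f \<longleftrightarrow>
     (\<forall>x. f differentiable (at x)) \<and> (\<forall>v. C_class n (\<lambda>x. frechet_derivative f (at x) v))"

definition smooth :: "(real ^ 'd \<Rightarrow> real) \<Rightarrow> bool" where
  "smooth f \<longleftrightarrow> (\<forall>n. C_class n f)"

text \<open>
  The comparisons with the Fourier transform use the order on the complex numbers in which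
  \<open>a \<le> z\<close> for real \<open>a\<close> means that \<open>z\<close> is real and at least \<open>a\<close>. The transform of a radial
  real-valued function is real, so this says exactly what is meant.
\<close>
definition cohn_elkies_feasible :: "real \<Rightarrow> (real ^ 'd \<Rightarrow> real) set" where
  "cohn_elkies_feasible r =
     {f. radial f \<and> smooth f \<and> rapidly_decreasing f \<and>
         f 0 > 0 \<and> fourier_transform f 0 \<ge> 1 \<and>
         (\<forall>x. norm x \<ge> r \<longrightarrow> f x \<le> 0) \<and>
         (\<forall>y. fourier_transform f y \<ge> 0)}"

text \<open>
  The dimension is \<open>CARD('d)\<close>, passed as a type argument. The infimum is taken in the extended
  reals, so that it is the usual greatest lower bound without any side condition on the set.
\<close>
definition cohn_elkies_bound :: "'d::finite itself \<Rightarrow> real \<Rightarrow> ereal" where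
  "cohn_elkies_bound _ r =
     (INF f \<in> (cohn_elkies_feasible r :: (real ^ 'd \<Rightarrow> real) set).
        ereal ((r / 2) ^ CARD('d) * f 0))"

end

theory Submission
  imports Defs "HOL-Computational_Algebra.Polynomial"
begin

text \<open>
The linear programming bound for sphere packings is bounded below by weak duality, with a dual
solution that comes from the Delsarte linear program for binary codes by reduction modulo \<open>2\<close>.

Rescale so that \<open>r = 2\<close>, and identify a subset \<open>S\<close> of the \<open>d\<close> coordinates with its indicator vector
\<open>v\<^sub>S\<close>. Give every point of \<open>v\<^sub>S + 2\<int>\<^sup>d\<close> the mass \<open>g S\<close>, where \<open>g {} = 1\<close>, \<open>g \<ge> 0\<close>, and \<open>g S = 0\<close> when
\<open>S\<close> has one, two or three elements. Every point other than the origin that carries mass then has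
norm at least \<open>2\<close>: it is a nonzero vector with even coordinates, or it has at least four odd
coordinates. If all character sums \<open>\<Sum>S. g S * (\<Prod>i\<in>S. \<epsilon> i)\<close> over signs \<open>\<epsilon>\<close> are nonnegative, then so is
the Fourier transform of this measure \<open>\<mu>\<close>, and Poisson summation would give
\<open>f 0 \<ge> \<integral> f d\<mu> \<ge> (\<Sum>S. g S) / 2\<^sup>d\<close> for every feasible \<open>f\<close>.

Poisson summation is replaced by a limit. The measure \<open>2\<^sup>d \<mu>\<close> is approximated by the trigonometric polynomial
\<open>W x = \<Sum>S. g S * K\<^sub>N (x - v\<^sub>S)\<close>, where \<open>K\<^sub>N\<close> is a product of Fejer kernels of period \<open>2\<close>. Its
coefficients are nonnegative, so \<open>\<integral> f W\<close> is a nonnegative combination of values of the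
transform of \<open>f\<close>, and keeping only the frequency zero leaves
\<open>(\<Sum>S. g S) * \<integral> f \<le> \<integral> f W\<close> (\<open>positive_definite_lower_bound\<close>). On the other side
\<open>W \<ge> 0\<close>, so \<open>f\<close> may be replaced by its positive part, which is continuous and supported in the ball of
radius \<open>2\<close>; the kernels concentrate at lattice points, and the positive part vanishes at all of those
with mass except the origin. Hence \<open>\<integral> f W\<close> is at most \<open>2\<^sup>d * f 0 + \<epsilon>\<close> for large \<open>N\<close>
(\<open>fejer_kernel_concentrates\<close>).

For \<open>d = 9\<close> the weights \<open>1/7\<close>, \<open>2/35\<close>, \<open>1/5\<close> on words of weight \<open>4\<close>, \<open>6\<close>, \<open>8\<close> satisfy all constraints and
have total mass \<open>128/5\<close>, so that the bound is \<open>(128/5) / 2\<^sup>9 = 1/20\<close>.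
\<close>

section \<open>The one-dimensional Fejer kernel\<close>

text \<open>
The Fejer kernel, rescaled to period \<open>2\<close> and mean \<open>1\<close>. As a squared modulus it is nonnegative;
expanding the square shows that its Fourier coefficients are nonnegative as well.
\<close>
definition fejer :: "nat \<Rightarrow> real \<Rightarrow> real" where
  "fejer N t = (cmod (\<Sum>j<N. cis (pi * real j * t)))\<^sup>2 / real N"

lemma fejer_nonneg: "0 \<le> fejer N t"
  by (simp add: fejer_def)

lemma continuous_fejer [continuous_intros]: "continuous_on A (fejer N)"
  unfolding fejer_def cis_conv_exp by (cases "N = 0") (auto intro!: continuous_intros)

lemma fejer_measurable [measurable]: "fejer N \<in> borel_measurable borel"
  by (intro borel_measurable_continuous_onI continuous_fejer)

lemma fejer_expand:
  "complex_of_real (fejer N t) =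
     (\<Sum>p\<in>{..<N} \<times> {..<N}. cis (pi * (real (fst p) - real (snd p)) * t) / of_nat N)"
proof -
  have "complex_of_real ((cmod (\<Sum>j<N. cis (pi * real j * t)))\<^sup>2) =
      (\<Sum>j<N. cis (pi * real j * t)) * (\<Sum>l<N. cis (- (pi * real l * t)))"
    by (simp only: complex_norm_square cnj_sum cis_cnj)
  also have "\<dots> = (\<Sum>p\<in>{..<N} \<times> {..<N}. cis (pi * (real (fst p) - real (snd p)) * t))"
    unfolding sum_product sum.cartesian_product
    by (intro sum.cong refl) (auto simp: cis_mult algebra_simps)
  finally show ?thesis
    by (simp add: fejer_def sum_divide_distrib)
qed

lemma fejer_expand_cos:
  "fejer N t = (\<Sum>p\<in>{..<N} \<times> {..<N}. cos (pi * (real (fst p) - real (snd p)) * t) / real N)"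
  using arg_cong[OF fejer_expand[of N t], of Re] by (simp add: Re_divide_of_nat)

text \<open>
The exponential sum is geometric, so multiplying it by \<open>1 - cis (pi * t)\<close>, whose modulus is
\<open>2 * \<bar>sin (pi * t / 2)\<bar>\<close>, leaves something of modulus at most \<open>2\<close>. As the total mass per
period does not depend on \<open>N\<close>, the inequality forces the mass to concentrate at the even integers.
\<close>
lemma sin2_fejer_le: "(sin (pi * t / 2))\<^sup>2 * fejer N t \<le> 1 / real N"
proof (cases "N = 0")
  case False
  let ?z = "cis (pi * t)" and ?s = "\<Sum>j<N. cis (pi * real j * t)"
  have s: "?s = (\<Sum>j<N. ?z ^ j)"
    by (intro sum.cong refl) (simp add: Complex.DeMoivre mult_ac)
  have "(1 - ?z) * ?s = 1 - ?z ^ N"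
    unfolding s by (rule one_diff_power_eq[symmetric])
  then have "cmod (1 - ?z) * cmod ?s = cmod (1 - ?z ^ N)"
    by (metis norm_mult)
  also have "\<dots> \<le> 2"
    by (rule order_trans[OF norm_triangle_ineq4]) (simp add: norm_power)
  finally have "(cmod (1 - ?z) * cmod ?s)\<^sup>2 \<le> 2\<^sup>2"
    by (intro power_mono) auto
  moreover have "(cmod (1 - ?z))\<^sup>2 = 4 * (sin (pi * t / 2))\<^sup>2"
  proof -
    have "(cmod (1 - ?z))\<^sup>2 = (1 - cos (pi * t))\<^sup>2 + (sin (pi * t))\<^sup>2"
      by (simp add: cmod_power2)
    also have "\<dots> = 2 - 2 * cos (2 * (pi * t / 2))"
      using sin_cos_squared_add[of "pi * t"] by (simp add: power2_eq_square algebra_simps)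
    also have "\<dots> = 4 * (sin (pi * t / 2))\<^sup>2"
      by (subst cos_double_sin) simp
    finally show ?thesis .
  qed
  ultimately have "(sin (pi * t / 2))\<^sup>2 * (cmod ?s)\<^sup>2 \<le> 1"
    by (simp add: power_mult_distrib)
  with False show ?thesis
    by (simp add: fejer_def divide_right_mono)
qed (simp add: fejer_def)

text \<open>
Over a whole number of periods only the diagonal terms of the double sum contribute.
\<close>
lemma has_integral_fejer:
  assumes "N > 0"
  shows "(fejer N has_integral (2 * real c)) {- real c..real c}"
proof -
  have cosint: "((\<lambda>t. cos (pi * (real j - real l) * t) / real N) has_integral
      (if j = l then 2 * real c / real N else 0)) {- real c..real c}" for j l
  proof (cases "j = l")
    case True
    then show ?thesis
      using has_integral_const_real[of "1 / real N" "- real c" "real c"] by simp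
  next
    case False
    define m where "m = int j - int l"
    have m: "real j - real l = of_int m" "m \<noteq> 0"
      using False by (auto simp: m_def)
    have sin0: "sin (pi * of_int m * real c) = 0"
      using sin_int_times_real[of "m * int c"] sin_times_pi_eq_0[of "real_of_int (m * int c)"]
      by (auto simp: mult_ac)
    have "((\<lambda>t. cos (pi * of_int m * t) / real N) has_integral
        sin (pi * of_int m * real c) / (pi * of_int m) / real N
        - sin (pi * of_int m * (- real c)) / (pi * of_int m) / real N) {- real c..real c}"
      using m(2) assms
      by (intro fundamental_theorem_of_calculus)
         (auto intro!: derivative_eq_intros simp flip: has_real_derivative_iff_has_vector_derivative)
    then show ?thesis
      using False sin0 m(1) by simp
  qed
  have "(fejer N has_integral
      (\<Sum>p\<in>{..<N} \<times> {..<N}. if fst p = snd p then 2 * real c / real N else 0)) {- real c..real c}"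
    unfolding fejer_expand_cos[abs_def] by (intro has_integral_sum cosint) auto
  also have "(\<Sum>p\<in>{..<N} \<times> {..<N}. if fst p = snd p then 2 * real c / real N else 0) = 2 * real c"
    using assms by (simp add: sum.cartesian_product' sum.delta)
  finally show ?thesis .
qed

section \<open>The Fejer kernel on a cube\<close>

text \<open>
Fubini for a product of functions of the separate coordinates on a symmetric cube.
\<close>
lemma has_bochner_integral_box_prod:
  fixes u :: "'d::finite \<Rightarrow> real \<Rightarrow> real"
  assumes meas [measurable]: "\<And>i. u i \<in> borel_measurable borel"
    and nonneg: "\<And>i t. 0 \<le> u i t"
    and int: "\<And>i. (u i has_integral I i) {-c..c}"
  shows "has_bochner_integral lborel
           (\<lambda>y::real^'d. indicator (cbox (\<chi> i. -c) (\<chi> i. c)) y * (\<Prod>i\<in>UNIV. u i (y $ i)))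
           (\<Prod>i\<in>UNIV. I i)"
proof (rule has_bochner_integral_nn_integral)
  have I: "0 \<le> I i" for i
    using has_integral_nonneg[OF int] nonneg by blast
  then show "0 \<le> (\<Prod>i\<in>UNIV. I i)"
    by (intro prod_nonneg) auto
  \<comment> \<open>The product formula for the Lebesgue measure is indexed by basis vectors,
    so the factors are transported from coordinates to the vectors \<open>axis i 1\<close>.\<close>
  define w :: "real^'d \<Rightarrow> real \<Rightarrow> ennreal"
    where "w b t = ennreal (indicator {-c..c} t * u (the_inv (\<lambda>i. axis i 1) b) t)" for b t
  have inj: "inj (\<lambda>i::'d. axis i (1::real))"
    by (auto simp: inj_def axis_eq_axis)
  have w: "w (axis i 1) t = ennreal (indicator {-c..c} t * u i t)" for i t
    by (simp add: w_def the_inv_f_f[OF inj])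
  have prod_Basis: "(\<Prod>b\<in>Basis. F b) = (\<Prod>i\<in>UNIV. F (axis i 1))" for F :: "real^'d \<Rightarrow> ennreal"
  proof -
    have "(Basis :: (real^'d) set) = range (\<lambda>i. axis i 1)"
      by (auto simp: Basis_vec_def)
    then have "prod F Basis = prod F (range (\<lambda>i. axis i 1))"
      by (rule arg_cong)
    also have "\<dots> = (\<Prod>i\<in>UNIV. F (axis i 1))"
      using prod.reindex[OF inj, of F] by (simp add: o_def)
    finally show ?thesis .
  qed
  have "(\<integral>\<^sup>+y. ennreal (indicator (cbox (\<chi> i. -c) (\<chi> i. c)) y * (\<Prod>i\<in>UNIV. u i (y $ i))) \<partial>lborel)
      = (\<integral>\<^sup>+y. (\<Prod>b\<in>Basis. w b (y \<bullet> b)) \<partial>lborel)"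
  proof (intro nn_integral_cong)
    fix y :: "real^'d"
    have "indicator (cbox (\<chi> i. -c) (\<chi> i. c)) y = (\<Prod>i\<in>UNIV. indicator {-c..c} (y $ i) :: real)"
      by (auto simp: indicator_def mem_box_cart)
    then show "ennreal (indicator (cbox (\<chi> i. -c) (\<chi> i. c)) y * (\<Prod>i\<in>UNIV. u i (y $ i))) = (\<Prod>b\<in>Basis. w b (y \<bullet> b))"
      by (simp add: prod_Basis w inner_axis prod_ennreal nonneg flip: prod.distrib)
  qed
  also have "\<dots> = (\<Prod>b\<in>Basis. \<integral>\<^sup>+t. w b t \<partial>lborel)"
    by (intro nn_integral_lborel_prod) (auto simp: w_def)
  also have "\<dots> = (\<Prod>i\<in>UNIV. ennreal (I i))"
    unfolding prod_Basis w
    by (intro prod.cong refl nn_integral_has_integral_lebesgue nonneg int)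
  also have "\<dots> = ennreal (\<Prod>i\<in>UNIV. I i)"
    using I by (simp add: prod_ennreal)
  finally show "(\<integral>\<^sup>+y. ennreal (indicator (cbox (\<chi> i. -c) (\<chi> i. c)) y * (\<Prod>i\<in>UNIV. u i (y $ i))) \<partial>lborel)
      = ennreal (\<Prod>i\<in>UNIV. I i)" .
qed (auto intro!: AE_I2 mult_nonneg_nonneg prod_nonneg simp: nonneg)

definition fejer_kernel :: "nat \<Rightarrow> real^'d::finite \<Rightarrow> real" where
  "fejer_kernel N x = (\<Prod>i\<in>UNIV. fejer N (x $ i))"

abbreviation cube :: "real \<Rightarrow> (real^'d::finite) set" where
  "cube c \<equiv> cbox (\<chi> i. - c) (\<chi> i. c)"

lemma fejer_kernel_nonneg: "0 \<le> fejer_kernel N x"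
  unfolding fejer_kernel_def by (intro prod_nonneg) (auto simp: fejer_nonneg)

lemma continuous_fejer_kernel [continuous_intros]:
  "continuous_on A g \<Longrightarrow> continuous_on A (\<lambda>x. fejer_kernel N (g x))"
  unfolding fejer_kernel_def
  by (intro continuous_intros continuous_on_compose2[OF continuous_fejer[of UNIV N]]) auto

lemma fejer_kernel_mass:
  assumes "N > 0"
  shows "has_bochner_integral lborel
           (\<lambda>y::real^'d::finite. indicator (cube (real c)) y * fejer_kernel N y) ((2 * real c) ^ CARD('d))"
  using has_bochner_integral_box_prod[OF fejer_measurable fejer_nonneg has_integral_fejer[OF assms], of c]
  by (simp add: fejer_kernel_def)

text \<open>
By \<open>sin2_fejer_le\<close> the factor for coordinate \<open>k\<close> may be replaced by the constant \<open>1 / N\<close>; the other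
factors keep their mass \<open>6\<close>.
\<close>
lemma fejer_kernel_sin2_mass:
  fixes k :: "'d::finite"
  assumes "N > 0"
  shows "integrable lborel (\<lambda>y::real^'d. indicator (cube 3) y * ((sin (pi * y $ k / 2))\<^sup>2 * fejer_kernel N y))"
    and "(LINT y|lborel. indicator (cube 3) y * ((sin (pi * (y::real^'d) $ k / 2))\<^sup>2 * fejer_kernel N y))
           \<le> 6 ^ CARD('d) / real N"
proof -
  define u :: "'d \<Rightarrow> real \<Rightarrow> real" where "u i t = (if i = k then 1 / real N else fejer N t)" for i t
  have split: "(\<Prod>i\<in>UNIV. g i) = g k * (\<Prod>i\<in>UNIV - {k}. g i)" for g :: "'d \<Rightarrow> real"
    by (simp add: prod.remove)
  have u: "has_bochner_integral lborel (\<lambda>y::real^'d. indicator (cube 3) y * (\<Prod>i\<in>UNIV. u i (y $ i)))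
      (\<Prod>i\<in>UNIV. if i = k then 6 / real N else 6)"
  proof (rule has_bochner_integral_box_prod)
    show "u i \<in> borel_measurable borel" for i
      unfolding u_def by measurable
    show "0 \<le> u i t" for i t
      by (simp add: u_def fejer_nonneg)
    show "(u i has_integral (if i = k then 6 / real N else 6)) {- 3..3}" for i
    proof (cases "i = k")
      case True
      then have "u i = (\<lambda>_. 1 / real N)"
        by (auto simp: u_def)
      then show ?thesis
        using True has_integral_const_real[of "1 / real N" "-3" 3] by simp
    next
      case False
      then have "u i = fejer N"
        by (auto simp: u_def)
      then show ?thesis
        using False has_integral_fejer[OF assms, of 3] by simp
    qed
  qed
  have mass: "(\<Prod>i::'d\<in>UNIV. if i = k then 6 / real N else 6) = 6 ^ CARD('d) / real N"
    by (simp add: split card_Diff_singleton power_eq_if)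
  have le: "(sin (pi * y $ k / 2))\<^sup>2 * fejer_kernel N y \<le> (\<Prod>i\<in>UNIV. u i (y $ i))" for y :: "real^'d"
  proof -
    have "(sin (pi * y $ k / 2))\<^sup>2 * fejer_kernel N y
        = (sin (pi * y $ k / 2))\<^sup>2 * fejer N (y $ k) * (\<Prod>i\<in>UNIV - {k}. fejer N (y $ i))"
      by (simp add: fejer_kernel_def split)
    also have "\<dots> \<le> 1 / real N * (\<Prod>i\<in>UNIV - {k}. fejer N (y $ i))"
      by (intro mult_right_mono sin2_fejer_le prod_nonneg) (auto simp: fejer_nonneg)
    also have "\<dots> = (\<Prod>i\<in>UNIV. u i (y $ i))"
      by (simp add: split u_def)
    finally show ?thesis .
  qed
  have cont: "continuous_on UNIV (\<lambda>y::real^'d. (sin (pi * y $ k / 2))\<^sup>2 * fejer_kernel N y)"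
    by (intro continuous_intros) auto
  show *: "integrable lborel (\<lambda>y::real^'d. indicator (cube 3) y * ((sin (pi * y $ k / 2))\<^sup>2 * fejer_kernel N y))"
    using borel_integrable_compact[OF compact_cbox continuous_on_subset[OF cont]]
    by simp
  show "(LINT y|lborel. indicator (cube 3) y * ((sin (pi * (y::real^'d) $ k / 2))\<^sup>2 * fejer_kernel N y))
           \<le> 6 ^ CARD('d) / real N"
    using u integral_mono[OF *, of "\<lambda>y. indicator (cube 3) y * (\<Prod>i\<in>UNIV. u i (y $ i))"] le
    by (auto simp: has_bochner_integral_iff mass intro!: mult_left_mono)
qed

section \<open>Concentration of the kernel on the even lattice\<close>

lemma even_lattice_point_if_sin2_sum_zero:
  fixes y :: "real^'d::finite"
  assumes "(\<Sum>i\<in>UNIV. (sin (pi * y $ i / 2))\<^sup>2) = 0"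
  shows "\<exists>n::int. y $ i = 2 * of_int n"
proof -
  have "(sin (pi * y $ i / 2))\<^sup>2 = 0"
    using assms by (subst (asm) sum_nonneg_eq_0_iff) auto
  then obtain n :: int where "pi * y $ i / 2 = of_int n * pi"
    by (auto simp: sin_zero_iff_int2)
  then have "y $ i = 2 * of_int n"
    by (simp add: field_simps)
  then show ?thesis ..
qed

text \<open>
The sum of squared sines vanishes exactly on the lattice of even integer vectors. On the compact set
where \<open>h\<close> exceeds \<open>\<epsilon>\<close> plus a bump of height \<open>h 0\<close> at the origin, that sum is positive by the
hypothesis on the zeros of \<open>h\<close>, hence bounded away from \<open>0\<close>, and a large multiple of it dominates \<open>h\<close>.
\<close>
lemma trigonometric_majorant:
  fixes h :: "real^'d::finite \<Rightarrow> real"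
  assumes cont: "continuous_on UNIV h" and nonneg: "\<And>y. 0 \<le> h y" and "\<epsilon> > 0"
    and zero: "\<And>y. y \<noteq> 0 \<Longrightarrow> (\<And>i. \<exists>n::int. y $ i = 2 * of_int n) \<Longrightarrow> h y = 0"
  obtains C where "C \<ge> 0"
    "\<And>y. y \<in> cube 3 \<Longrightarrow>
       h y \<le> \<epsilon> + h 0 * indicator (cube 1) y + C * (\<Sum>i\<in>UNIV. (sin (pi * y $ i / 2))\<^sup>2)"
proof -
  let ?D = "\<lambda>y::real^'d. \<Sum>i\<in>UNIV. (sin (pi * y $ i / 2))\<^sup>2"
  \<comment> \<open>A continuous bump below the indicator of \<open>cube 1\<close>; its continuity makes the set \<open>A\<close> closed.\<close>
  let ?p = "\<lambda>y::real^'d. max 0 (1 - norm y)"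
  have contD: "continuous_on UNIV ?D"
    by (intro continuous_intros) auto
  have D0: "0 \<le> ?D y" for y
    by (intro sum_nonneg) auto
  have p: "?p y \<le> indicator (cube 1) y" for y :: "real^'d"
  proof (cases "norm y \<le> 1")
    case True
    then have "\<bar>y $ i\<bar> \<le> 1" for i
      using component_le_norm_cart[of y i] by linarith
    then have "y \<in> cube 1"
      by (auto simp: mem_box_cart abs_le_iff minus_le_iff)
    then show ?thesis by simp
  qed (auto simp: indicator_def)
  define A where "A = cube 3 \<inter> {y. \<epsilon> + h 0 * ?p y \<le> h y}"
  have "compact A"
    unfolding A_def
    by (intro compact_Int_closed compact_cbox closed_Collect_le continuous_intros cont)
  have D_pos: "?D y > 0" if "y \<in> A" for y
  proof (rule ccontr)
    assume "\<not> ?D y > 0"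
    with D0[of y] have "?D y = 0" by linarith
    then have "h y = 0" if "y \<noteq> 0"
      using zero[OF that] even_lattice_point_if_sin2_sum_zero[of y] by blast
    moreover have "\<epsilon> + h 0 * ?p y \<le> h y"
      using that by (simp add: A_def)
    moreover have "0 \<le> h 0 * ?p y"
      using nonneg by simp
    ultimately show False
      using \<open>\<epsilon> > 0\<close> by (cases "y = 0") auto
  qed
  have "\<exists>\<eta>>0. \<forall>y\<in>A. \<eta> \<le> ?D y"
  proof (cases "A = {}")
    case False
    obtain y0 where "y0 \<in> A" "\<forall>y\<in>A. ?D y0 \<le> ?D y"
      using continuous_attains_inf[OF \<open>compact A\<close> False continuous_on_subset[OF contD]] by auto
    with D_pos show ?thesis by blast
  qed (auto intro: exI[of _ 1])
  then obtain \<eta> where \<eta>: "\<eta> > 0" "\<And>y. y \<in> A \<Longrightarrow> \<eta> \<le> ?D y" by blast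
  have "cube 3 \<noteq> ({} :: (real^'d) set)"
    by (auto simp: interval_ne_empty_cart)
  then obtain y1 where y1: "\<forall>y\<in>cube 3. h y \<le> h (y1::real^'d)"
    using continuous_attains_sup[OF compact_cbox _ continuous_on_subset[OF cont]] by blast
  show thesis
  proof (rule that)
    show "0 \<le> h y1 / \<eta>"
      using \<eta> nonneg by simp
    fix y :: "real^'d"
    assume y: "y \<in> cube 3"
    have ind: "h 0 * ?p y \<le> h 0 * indicator (cube 1) y"
      using p nonneg by (intro mult_left_mono)
    have CD: "0 \<le> h y1 / \<eta> * ?D y"
      using \<eta> nonneg D0 by (intro mult_nonneg_nonneg divide_nonneg_pos)
    show "h y \<le> \<epsilon> + h 0 * indicator (cube 1) y + h y1 / \<eta> * ?D y"
    proof (cases "y \<in> A")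
      case True
      have "h y \<le> h y1 / \<eta> * \<eta>"
        using y1 y \<eta> by simp
      also have "\<dots> \<le> h y1 / \<eta> * ?D y"
        using \<eta> True nonneg by (intro mult_left_mono divide_nonneg_pos) auto
      finally have "h y \<le> h y1 / \<eta> * ?D y" .
      moreover have "0 \<le> h 0 * indicator (cube 1) y"
        using nonneg by simp
      ultimately show ?thesis
        using \<open>\<epsilon> > 0\<close> by linarith
    next
      case False
      then have "h y < \<epsilon> + h 0 * ?p y"
        using y by (simp add: A_def)
      with ind CD show ?thesis by linarith
    qed
  qed
qed

text \<open>
Integrating the majorant of \<open>h\<close> against the kernel, the indicator of \<open>cube 1\<close> (a single period)
contributes \<open>2\<^sup>d * h 0\<close>, the constant contributes \<open>6\<^sup>d\<close> times itself, and the squared sines contribute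
\<open>O(1/N)\<close>.
\<close>
lemma fejer_kernel_concentrates:
  fixes h :: "real^'d::finite \<Rightarrow> real"
  assumes cont: "continuous_on UNIV h" and nonneg: "\<And>y. 0 \<le> h y" and "\<epsilon> > 0"
    and supp: "\<And>y. y \<notin> cube 3 \<Longrightarrow> h y = 0"
    and zero: "\<And>y. y \<noteq> 0 \<Longrightarrow> (\<And>i. \<exists>n::int. y $ i = 2 * of_int n) \<Longrightarrow> h y = 0"
  shows "\<forall>\<^sub>F N in sequentially. (LINT y|lborel. h y * fejer_kernel N y) \<le> 2 ^ CARD('d) * h 0 + \<epsilon>"
proof -
  let ?d = "CARD('d)"
  define \<delta> where "\<delta> = \<epsilon> / (2 * 6 ^ ?d)"
  have "\<delta> > 0"
    using \<open>\<epsilon> > 0\<close> by (simp add: \<delta>_def)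
  obtain C where C: "C \<ge> 0" "\<And>y. y \<in> cube 3 \<Longrightarrow>
       h y \<le> \<delta> + h 0 * indicator (cube 1) y + C * (\<Sum>i\<in>UNIV. (sin (pi * y $ i / 2))\<^sup>2)"
    using trigonometric_majorant[OF cont nonneg \<open>\<delta> > 0\<close> zero] by blast
  have bound: "(LINT y|lborel. h y * fejer_kernel N y)
      \<le> 2 ^ ?d * h 0 + \<epsilon> / 2 + C * (real ?d * (6 ^ ?d / real N))" if "N > 0" for N
  proof -
    define G where "G i y = indicator (cube 3) y * ((sin (pi * y $ i / 2))\<^sup>2 * fejer_kernel N y)"
      for i and y :: "real^'d"
    let ?R = "\<lambda>y::real^'d. \<delta> * (indicator (cube 3) y * fejer_kernel N y)
        + h 0 * (indicator (cube 1) y * fejer_kernel N y) + C * (\<Sum>i\<in>UNIV. G i y)"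
    note mass3 = fejer_kernel_mass[OF that, of 3, where 'd='d, simplified, unfolded has_bochner_integral_iff]
    note mass1 = fejer_kernel_mass[OF that, of 1, where 'd='d, simplified, unfolded has_bochner_integral_iff]
    have G: "integrable lborel (G i)" "integral\<^sup>L lborel (G i) \<le> 6 ^ ?d / real N" for i
      using fejer_kernel_sin2_mass[OF that, of i] by (simp_all add: G_def[abs_def])
    have sub: "y \<in> cube 3" if "y \<in> cube 1" for y :: "real^'d"
    proof -
      have "- 3 \<le> y $ i \<and> y $ i \<le> 3" for i
        using that by (auto simp: mem_box_cart dest!: spec[of _ i])
      then show ?thesis
        by (simp add: mem_box_cart)
    qed
    have eq: "h y * fejer_kernel N y = indicator (cube 3) y * (h y * fejer_kernel N y)" for y
      using supp[of y] by (auto simp: indicator_def)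
    have "continuous_on UNIV (\<lambda>y. h y * fejer_kernel N y)"
      by (intro continuous_intros cont)
    then have int: "integrable lborel (\<lambda>y. h y * fejer_kernel N y)"
      using borel_integrable_compact[OF compact_cbox continuous_on_subset, of UNIV "\<lambda>y. h y * fejer_kernel N y" "\<chi> i. -3" "\<chi> i. 3"]
      by (subst eq) simp
    have le: "h y * fejer_kernel N y \<le> ?R y" for y
    proof (cases "y \<in> cube 3")
      case True
      have "h y * fejer_kernel N y \<le>
          (\<delta> + h 0 * indicator (cube 1) y + C * (\<Sum>i\<in>UNIV. (sin (pi * y $ i / 2))\<^sup>2)) * fejer_kernel N y"
        using C(2)[OF True] fejer_kernel_nonneg by (rule mult_right_mono)
      also have "\<dots> = ?R y"
        using True by (simp add: G_def algebra_simps sum_distrib_left sum_distrib_right)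
      finally show ?thesis .
    next
      case False
      then show ?thesis
        using sub[of y] supp[of y] by (auto simp: G_def indicator_def)
    qed
    have "(LINT y|lborel. h y * fejer_kernel N y) \<le> integral\<^sup>L lborel ?R"
      using mass1 mass3 G(1) by (intro integral_mono int le) auto
    also have "\<dots> = \<delta> * 6 ^ ?d + h 0 * 2 ^ ?d + C * (\<Sum>i\<in>UNIV. integral\<^sup>L lborel (G i))"
      using mass1 mass3 G(1) by simp
    also have "\<dots> \<le> \<delta> * 6 ^ ?d + h 0 * 2 ^ ?d + C * (real ?d * (6 ^ ?d / real N))"
      using sum_bounded_above[of UNIV, OF G(2)] by (intro add_left_mono mult_left_mono C(1))
    also have "\<delta> * 6 ^ ?d = \<epsilon> / 2"
      by (simp add: \<delta>_def)
    finally show ?thesis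
      by (simp add: algebra_simps)
  qed
  have "(\<lambda>N. C * (real ?d * (6 ^ ?d / real N))) \<longlonglongrightarrow> C * (real ?d * 0)"
    by (intro tendsto_intros lim_const_over_n)
  then have "\<forall>\<^sub>F N in sequentially. C * (real ?d * (6 ^ ?d / real N)) < \<epsilon> / 2"
    using \<open>\<epsilon> > 0\<close> by (intro order_tendstoD) auto
  then show ?thesis
    using eventually_gt_at_top[of 0]
  proof eventually_elim
    case (elim N)
    then show ?case using bound[of N] by linarith
  qed
qed

section \<open>Fourier expansion of translated kernels\<close>

definition corner :: "'d set \<Rightarrow> real^'d" where
  "corner S = (\<chi> i. if i \<in> S then 1 else 0)"

lemma prod_cis: "(\<Prod>i\<in>A. cis (f i)) = cis (\<Sum>i\<in>A. f i)"
  by (induction A rule: infinite_finite_induct) (auto simp: cis_mult)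

lemma cis_shift_by_one:
  "cis (pi * (real a - real b) * (t - 1)) = (- 1) ^ (a + b) * cis (pi * (real a - real b) * t)"
proof -
  have "cis (pi * (real a - real b) * (t - 1)) = cis (pi * (real a - real b) * t) * cis (- (pi * real a)) * cis (pi * real b)"
    by (simp add: cis_mult algebra_simps)
  also have "cis (- (pi * real a)) = (- 1) ^ a" for a
    by (simp add: complex_eq_iff cis.code flip: cis_cnj)
  also have "cis (pi * real b) = (- 1) ^ b"
    by (simp add: complex_eq_iff cis.code)
  finally show ?thesis
    by (simp add: power_add)
qed

text \<open>
Multiplying out the \<open>d\<close> double sums of the Fejer kernels gives one term for every choice \<open>p\<close> of a pair
\<open>(a, b)\<close> in each coordinate; its frequency in that coordinate is \<open>a - b\<close>. Keeping the pairs, rather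
than collecting equal frequencies, makes all coefficients equal to \<open>1 / N\<^sup>d\<close>.
\<close>
definition frequencies :: "nat \<Rightarrow> ('d \<Rightarrow> nat \<times> nat) set" where
  "frequencies N = PiE UNIV (\<lambda>_. {..<N} \<times> {..<N})"

definition phase :: "('d \<Rightarrow> nat \<times> nat) \<Rightarrow> real^'d::finite \<Rightarrow> real" where
  "phase p x = pi * (\<Sum>i\<in>UNIV. (real (fst (p i)) - real (snd (p i))) * x $ i)"

text \<open>
The value of \<open>cis (pi * (a - b))\<close>, by which a term of the expansion changes when the coordinate is
shifted by \<open>1\<close>. The exponent \<open>a + b\<close> stands for \<open>a - b\<close>, which has the same parity.
\<close>
definition parity_sign :: "('d \<Rightarrow> nat \<times> nat) \<Rightarrow> 'd \<Rightarrow> real" where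
  "parity_sign p i = (- 1) ^ (fst (p i) + snd (p i))"

lemma finite_frequencies [simp]: "finite (frequencies N :: ('d::finite \<Rightarrow> nat \<times> nat) set)"
  unfolding frequencies_def by (intro finite_PiE) auto

text \<open>
Translating by a corner of the unit cube only changes signs: it multiplies each term by a character
of the group of binary words, evaluated at \<open>S\<close>.
\<close>
lemma fejer_kernel_expand:
  fixes x :: "real^'d::finite"
  shows "fejer_kernel N (x - corner S) =
    (\<Sum>p\<in>frequencies N. (\<Prod>i\<in>S. parity_sign p i) * cos (phase p x)) / real N ^ CARD('d)"
proof -
  define e :: "'d \<Rightarrow> nat \<times> nat \<Rightarrow> complex"
    where "e i q = (if i \<in> S then (- 1) ^ (fst q + snd q) else 1)" for i q
  have factor: "complex_of_real (fejer N ((x - corner S) $ i)) =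
      (\<Sum>q\<in>{..<N} \<times> {..<N}. e i q * cis (pi * (real (fst q) - real (snd q)) * x $ i) / of_nat N)" for i
    unfolding fejer_expand
    by (intro sum.cong refl) (simp add: e_def corner_def cis_shift_by_one)
  \<comment> \<open>The product over coordinates is expanded for the complex exponentials,
    which are multiplicative; the cosines are obtained by taking real parts at the end.\<close>
  have "complex_of_real (fejer_kernel N (x - corner S)) =
      (\<Sum>p\<in>frequencies N. \<Prod>i\<in>UNIV. e i (p i) * cis (pi * (real (fst (p i)) - real (snd (p i))) * x $ i) / of_nat N)"
    unfolding fejer_kernel_def of_real_prod factor frequencies_def
    by (rule prod_sum_PiE) auto
  also have "\<dots> = (\<Sum>p\<in>frequencies N. complex_of_real (\<Prod>i\<in>S. parity_sign p i) * cis (phase p x) / of_nat N ^ CARD('d))"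
  proof (intro sum.cong refl)
    fix p :: "'d \<Rightarrow> nat \<times> nat"
    have "(\<Prod>i\<in>UNIV. e i (p i)) = (\<Prod>i\<in>S. (- 1) ^ (fst (p i) + snd (p i)))"
      unfolding e_def by (simp add: prod.If_cases)
    then show "(\<Prod>i\<in>UNIV. e i (p i) * cis (pi * (real (fst (p i)) - real (snd (p i))) * x $ i) / of_nat N)
        = complex_of_real (\<Prod>i\<in>S. parity_sign p i) * cis (phase p x) / of_nat N ^ CARD('d)"
      by (simp add: prod.distrib prod_dividef prod_cis parity_sign_def phase_def sum_distrib_left mult.assoc)
  qed
  finally have eq: "complex_of_real (fejer_kernel N (x - corner S)) =
      complex_of_real ((\<Sum>p\<in>frequencies N. (\<Prod>i\<in>S. parity_sign p i) * cos (phase p x)) / real N ^ CARD('d))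
      + \<i> * complex_of_real ((\<Sum>p\<in>frequencies N. (\<Prod>i\<in>S. parity_sign p i) * sin (phase p x)) / real N ^ CARD('d))"
    by (simp add: cis_conv_exp exp_Euler cos_of_real sin_of_real sum_divide_distrib sum.distrib
        sum_distrib_left algebra_simps add_divide_distrib)
  show ?thesis
    using arg_cong[OF eq, of Re] by (simp only: plus_complex.sel Re_complex_of_real Re_i_times Im_complex_of_real)
qed

lemma integrable_mult_cos_phase:
  fixes f :: "real^'d::finite \<Rightarrow> real"
  assumes "integrable lborel f"
  shows "integrable lborel (\<lambda>x. f x * cos (phase p x))"
proof (rule Bochner_Integration.integrable_bound[OF assms])
  have "continuous_on UNIV (\<lambda>x::real^'d. cos (phase p x))"
    unfolding phase_def by (intro continuous_intros)
  then have "(\<lambda>x::real^'d. cos (phase p x)) \<in> borel_measurable lborel"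
    by (simp add: borel_measurable_continuous_onI)
  then show "(\<lambda>x. f x * cos (phase p x)) \<in> borel_measurable lborel"
    using assms by (intro borel_measurable_times) auto
  show "AE x in lborel. norm (f x * cos (phase p x)) \<le> norm (f x)"
    by (intro AE_I2) (simp add: abs_mult mult_left_le)
qed

lemma integrable_mult_fejer_kernel:
  fixes f :: "real^'d::finite \<Rightarrow> real"
  assumes "integrable lborel f"
  shows "integrable lborel (\<lambda>x. f x * fejer_kernel N (x - corner S))"
proof -
  have "integrable lborel (\<lambda>x. (\<Sum>p\<in>frequencies N. (\<Prod>i\<in>S. parity_sign p i) * (f x * cos (phase p x))) / real N ^ CARD('d))"
    by (intro integrable_divide Bochner_Integration.integrable_sum integrable_mult_right integrable_mult_cos_phase assms)
  then show ?thesis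
    unfolding fejer_kernel_expand by (simp add: sum_distrib_left mult_ac)
qed

text \<open>
After expansion the weighted sum of translated kernels has coefficients \<open>ghat p / N\<^sup>d \<ge> 0\<close>, so every
term of the integral is nonnegative. The terms that are kept are those with equal pairs in all
coordinates: there are \<open>N\<^sup>d\<close> of them and each has frequency zero.
\<close>
lemma positive_definite_lower_bound:
  fixes \<phi> :: "real^'d::finite \<Rightarrow> real" and g :: "'d set \<Rightarrow> real"
  assumes int: "integrable lborel \<phi>"
    and fourier: "\<And>m::'d \<Rightarrow> int. 0 \<le> (LINT x|lborel. \<phi> x * cos (pi * (\<Sum>i\<in>UNIV. of_int (m i) * x $ i)))"
    and dual: "\<And>\<epsilon>::'d \<Rightarrow> real. (\<And>i. \<epsilon> i = 1 \<or> \<epsilon> i = - 1) \<Longrightarrow> 0 \<le> (\<Sum>S\<in>UNIV. g S * (\<Prod>i\<in>S. \<epsilon> i))"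
    and "N > 0"
  shows "(\<Sum>S\<in>UNIV. g S) * (LINT x|lborel. \<phi> x)
           \<le> (LINT x|lborel. \<phi> x * (\<Sum>S\<in>UNIV. g S * fejer_kernel N (x - corner S)))"
proof -
  define ghat :: "('d \<Rightarrow> nat \<times> nat) \<Rightarrow> real"
    where "ghat p = (\<Sum>S\<in>UNIV. g S * (\<Prod>i\<in>S. parity_sign p i))" for p
  define I where "I p = (LINT x|lborel. \<phi> x * cos (phase p x))" for p
  define diag :: "('d \<Rightarrow> nat \<times> nat) set" where "diag = PiE UNIV (\<lambda>_. Id_on {..<N})"
  have ghat_nonneg: "0 \<le> ghat p" for p
    unfolding ghat_def parity_sign_def by (intro dual) (metis minus_one_power_iff)
  have I_nonneg: "0 \<le> I p" for p
    using fourier[of "\<lambda>i. int (fst (p i)) - int (snd (p i))"] by (simp add: I_def phase_def)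
  have "(\<Sum>S\<in>UNIV. g S * fejer_kernel N (x - corner S)) = (\<Sum>p\<in>frequencies N. ghat p * cos (phase p x)) / real N ^ CARD('d)"
    for x :: "real^'d"
    unfolding fejer_kernel_expand ghat_def sum_distrib_left sum_distrib_right times_divide_eq_right
      sum_divide_distrib[symmetric]
    by (subst sum.swap) (simp add: mult.assoc)
  then have "(LINT x|lborel. \<phi> x * (\<Sum>S\<in>UNIV. g S * fejer_kernel N (x - corner S)))
      = (LINT x|lborel. (\<Sum>p\<in>frequencies N. ghat p * (\<phi> x * cos (phase p x))) / real N ^ CARD('d))"
    by (simp add: sum_distrib_left mult_ac)
  also have "\<dots> = (\<Sum>p\<in>frequencies N. ghat p * I p) / real N ^ CARD('d)"
    using integrable_mult_cos_phase[OF int] by (simp add: I_def)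
  also have "\<dots> \<ge> (\<Sum>p\<in>diag. ghat p * I p) / real N ^ CARD('d)"
    using ghat_nonneg I_nonneg
    by (intro divide_right_mono sum_mono2 finite_frequencies)
       (auto simp: diag_def frequencies_def intro: mult_nonneg_nonneg dest: PiE_mem)
  also have "(\<Sum>p\<in>diag. ghat p * I p) = (\<Sum>p\<in>diag. (\<Sum>S\<in>UNIV. g S) * (LINT x|lborel. \<phi> x))"
  proof (intro sum.cong refl)
    fix p assume "p \<in> diag"
    then have "fst (p i) = snd (p i)" for i
      using PiE_mem[of p UNIV "\<lambda>_. Id_on {..<N}" i] by (auto simp: diag_def)
    then show "ghat p * I p = (\<Sum>S\<in>UNIV. g S) * (LINT x|lborel. \<phi> x)"
      by (simp add: ghat_def I_def parity_sign_def phase_def flip: mult_2)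
  qed
  also have "\<dots> / real N ^ CARD('d) = (\<Sum>S\<in>UNIV. g S) * (LINT x|lborel. \<phi> x)"
  proof -
    have "Id_on {..<N} = (\<lambda>j. (j, j)) ` {..<N}"
      by (auto simp: Id_on_def)
    then have "card (Id_on {..<N}) = N"
      by (simp add: card_image inj_on_def)
    then have "card diag = N ^ CARD('d)"
      by (simp add: diag_def card_PiE)
    then show ?thesis
      using \<open>N > 0\<close> by simp
  qed
  finally show ?thesis .
qed

section \<open>The bound from positive definite weights on binary words\<close>

text \<open>
Four odd coordinates already contribute \<open>4\<close> to the square of the norm.
\<close>
lemma two_le_norm_odd_coset:
  fixes y :: "real^'d::finite"
  assumes even: "\<And>i. \<exists>n::int. y $ i = 2 * of_int n" and "card S \<ge> 4"
  shows "2 \<le> norm (y + corner S)"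
proof -
  have "1 \<le> ((y + corner S) $ i)\<^sup>2" if "i \<in> S" for i
  proof -
    obtain n :: int where "y $ i = 2 * of_int n"
      using even by blast
    with that have "(y + corner S) $ i = of_int (2 * n + 1)"
      by (simp add: corner_def)
    moreover have "1 \<le> (2 * n + 1)\<^sup>2"
      by (simp add: int_one_le_iff_zero_less) presburger
    ultimately show ?thesis
      by (metis of_int_1_le_iff of_int_power)
  qed
  then have "real (card S) * 1 \<le> (\<Sum>i\<in>S. ((y + corner S) $ i)\<^sup>2)"
    by (intro sum_bounded_below) auto
  also have "\<dots> \<le> (\<Sum>i\<in>UNIV. ((y + corner S) $ i)\<^sup>2)"
    by (intro sum_mono2) auto
  also have "\<dots> = (norm (y + corner S))\<^sup>2"
    by (simp add: norm_vec_def L2_set_def sum_nonneg)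
  finally have "2\<^sup>2 \<le> (norm (y + corner S))\<^sup>2"
    using assms(2) by simp
  then show ?thesis
    by (rule power2_le_imp_le) simp
qed

lemma two_le_norm_even_lattice:
  fixes y :: "real^'d::finite"
  assumes even: "\<And>i. \<exists>n::int. y $ i = 2 * of_int n" and "y \<noteq> 0"
  shows "2 \<le> norm y"
proof -
  obtain i where "y $ i \<noteq> 0"
    using \<open>y \<noteq> 0\<close> by (auto simp: vec_eq_iff)
  moreover obtain n :: int where n: "y $ i = 2 * of_int n"
    using even by blast
  ultimately have "1 \<le> \<bar>n\<bar>"
    by auto
  then have "2 \<le> \<bar>y $ i\<bar>"
    unfolding n by linarith
  then show ?thesis
    using component_le_norm_cart[of y i] by linarith
qed

text \<open>
Weak duality at radius \<open>2\<close>, by squeezing \<open>\<integral> \<phi> W\<close> between the two estimates explained at the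
beginning.
\<close>
theorem code_dual_bound:
  fixes \<phi> :: "real^'d::finite \<Rightarrow> real" and g :: "'d set \<Rightarrow> real"
  assumes cont: "continuous_on UNIV \<phi>" and int: "integrable lborel \<phi>"
    and "0 \<le> \<phi> 0" and nonpos: "\<And>x. 2 \<le> norm x \<Longrightarrow> \<phi> x \<le> 0"
    and fourier: "\<And>m::'d \<Rightarrow> int. 0 \<le> (LINT x|lborel. \<phi> x * cos (pi * (\<Sum>i\<in>UNIV. of_int (m i) * x $ i)))"
    and g_nonneg: "\<And>S. 0 \<le> g S" and "g {} = 1"
    and min_dist: "\<And>S. S \<noteq> {} \<Longrightarrow> card S < 4 \<Longrightarrow> g S = 0"
    and dual: "\<And>\<epsilon>::'d \<Rightarrow> real. (\<And>i. \<epsilon> i = 1 \<or> \<epsilon> i = - 1) \<Longrightarrow> 0 \<le> (\<Sum>S\<in>UNIV. g S * (\<Prod>i\<in>S. \<epsilon> i))"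
  shows "(\<Sum>S\<in>UNIV. g S) * (LINT x|lborel. \<phi> x) \<le> 2 ^ CARD('d) * \<phi> 0"
proof -
  define h where "h x = max (\<phi> x) 0" for x
  have h_cont: "continuous_on UNIV h"
    unfolding h_def by (intro continuous_intros cont)
  have h_int: "integrable lborel h"
    unfolding h_def using int by (intro integrable_max) auto
  have h_nonneg: "0 \<le> h x" for x
    by (simp add: h_def)
  have h_zero: "h x = 0" if "2 \<le> norm x" for x
    using nonpos[OF that] by (simp add: h_def)
  have h_0: "h 0 = \<phi> 0"
    using \<open>0 \<le> \<phi> 0\<close> by (simp add: h_def)
  define J where "J N S = (LINT y|lborel. h (y + corner S) * fejer_kernel N y)" for N S
  have limit: "\<forall>\<^sub>F N in sequentially. g S * J N S \<le> (if S = {} then 2 ^ CARD('d) * \<phi> 0 else 0) + g S * \<epsilon>"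
    if "\<epsilon> > 0" for S and \<epsilon> :: real
  proof (cases "S = {} \<or> 4 \<le> card S")
    case True
    \<comment> \<open>After the translation the function is supported in \<open>cube 3\<close>, three full periods in each coordinate,
      because the corner moves coordinates by at most \<open>1\<close>.\<close>
    have "\<forall>\<^sub>F N in sequentially. J N S \<le> 2 ^ CARD('d) * h (0 + corner S) + \<epsilon>"
      unfolding J_def
    proof (rule fejer_kernel_concentrates[OF _ h_nonneg \<open>\<epsilon> > 0\<close>])
      show "continuous_on UNIV (\<lambda>y. h (y + corner S))"
        by (intro continuous_on_compose2[OF h_cont] continuous_intros) auto
    next
      fix y :: "real^'d" assume "y \<notin> cube 3"
      then obtain i where "3 \<le> \<bar>y $ i\<bar>"
        by (auto simp: mem_box_cart not_le abs_real_def split: if_splits) (smt (verit))+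
      then have "2 \<le> \<bar>(y + corner S) $ i\<bar>"
        by (auto simp: corner_def)
      also have "\<dots> \<le> norm (y + corner S)"
        by (rule component_le_norm_cart)
      finally show "h (y + corner S) = 0"
        by (rule h_zero)
    next
      fix y :: "real^'d" assume y: "y \<noteq> 0" "\<And>i. \<exists>n::int. y $ i = 2 * of_int n"
      have "2 \<le> norm (y + corner S)"
        using True two_le_norm_even_lattice[OF y(2,1)] two_le_norm_odd_coset[OF y(2)]
        by (auto simp: corner_def zero_vec_def[symmetric])
      then show "h (y + corner S) = 0"
        by (rule h_zero)
    qed
    moreover have "h (0 + corner S) = (if S = {} then \<phi> 0 else 0)"
    proof (cases "S = {}")
      case False
      then have "2 \<le> norm (0 + corner S :: real^'d)"
        using True by (intro two_le_norm_odd_coset) (auto intro: exI[of _ 0])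
      with False show ?thesis
        using h_zero by metis
    qed (simp add: corner_def h_0 zero_vec_def[symmetric])
    ultimately have "\<forall>\<^sub>F N in sequentially. J N S \<le> (if S = {} then 2 ^ CARD('d) * \<phi> 0 else 0) + \<epsilon>"
      by (auto split: if_splits)
    then show ?thesis
    proof eventually_elim
      case (elim N)
      show ?case
        using mult_left_mono[OF elim g_nonneg[of S]] \<open>g {} = 1\<close>
        by (cases "S = {}") (simp_all add: distrib_left)
    qed
  qed (use min_dist in auto)
  have main: "(\<Sum>S\<in>UNIV. g S) * (LINT x|lborel. \<phi> x) \<le> 2 ^ CARD('d) * \<phi> 0 + \<epsilon> * (\<Sum>S\<in>UNIV. g S)"
    if "\<epsilon> > 0" for \<epsilon>
  proof -
    have "\<forall>\<^sub>F N in sequentially. \<forall>S\<in>UNIV. g S * J N S \<le> (if S = {} then 2 ^ CARD('d) * \<phi> 0 else 0) + g S * \<epsilon>"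
      by (intro eventually_ball_finite) (use limit[OF that] in auto)
    then have "\<forall>\<^sub>F N in sequentially. 0 < N \<and> (\<forall>S\<in>UNIV. g S * J N S \<le> (if S = {} then 2 ^ CARD('d) * \<phi> 0 else 0) + g S * \<epsilon>)"
      using eventually_gt_at_top[of 0] by eventually_elim auto
    then obtain N where N: "0 < N"
      "\<And>S. g S * J N S \<le> (if S = {} then 2 ^ CARD('d) * \<phi> 0 else 0) + g S * \<epsilon>"
      using eventually_happens'[OF sequentially_bot] by blast
    define W where "W x = (\<Sum>S\<in>UNIV. g S * fejer_kernel N (x - corner S))" for x :: "real^'d"
    have W_nonneg: "0 \<le> W x" for x
      unfolding W_def by (intro sum_nonneg mult_nonneg_nonneg g_nonneg fejer_kernel_nonneg)
    have times_W: "f x * W x = (\<Sum>S\<in>UNIV. g S * (f x * fejer_kernel N (x - corner S)))" for f and x :: "real^'d"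
      by (simp add: W_def sum_distrib_left mult_ac)
    have W_int: "integrable lborel (\<lambda>x. f x * W x)" if "integrable lborel f" for f
      unfolding times_W
      by (intro Bochner_Integration.integrable_sum integrable_mult_right integrable_mult_fejer_kernel that)
    have "(\<Sum>S\<in>UNIV. g S) * (LINT x|lborel. \<phi> x) \<le> (LINT x|lborel. \<phi> x * W x)"
      unfolding W_def by (rule positive_definite_lower_bound[OF int fourier dual N(1)])
    also have "\<dots> \<le> (LINT x|lborel. h x * W x)"
      by (intro integral_mono W_int int h_int mult_right_mono W_nonneg) (simp add: h_def)
    also have "\<dots> = (\<Sum>S\<in>UNIV. g S * (LINT x|lborel. h x * fejer_kernel N (x - corner S)))"
      unfolding times_W using integrable_mult_fejer_kernel[OF h_int] by simp
    also have "\<dots> = (\<Sum>S\<in>UNIV. g S * J N S)"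
    proof (intro sum.cong refl arg_cong2[where f="(*)"])
      fix S :: "'d set"
      have "continuous_on UNIV (\<lambda>x. h x * fejer_kernel N (x - corner S))"
        by (intro continuous_intros h_cont)
      then have "(LINT x|distr lborel borel ((+) (corner S)). h x * fejer_kernel N (x - corner S)) = J N S"
        unfolding J_def by (subst integral_distr) (auto intro: borel_measurable_continuous_onI simp: add.commute)
      then show "(LINT x|lborel. h x * fejer_kernel N (x - corner S)) = J N S"
        by (simp add: lborel_distr_plus)
    qed
    also have "\<dots> \<le> (\<Sum>S\<in>UNIV. (if S = {} then 2 ^ CARD('d) * \<phi> 0 else 0) + g S * \<epsilon>)"
      by (intro sum_mono N(2))
    also have "\<dots> = 2 ^ CARD('d) * \<phi> 0 + \<epsilon> * (\<Sum>S\<in>UNIV. g S)"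
      by (simp add: sum.distrib sum_distrib_left mult.commute)
    finally show ?thesis .
  qed
  have lim: "((\<lambda>\<epsilon>. 2 ^ CARD('d) * \<phi> 0 + \<epsilon> * (\<Sum>S\<in>UNIV. g S)) \<longlongrightarrow> 2 ^ CARD('d) * \<phi> 0 + 0 * (\<Sum>S\<in>UNIV. g S)) (at_right 0)"
    by (intro tendsto_intros)
  have "\<forall>\<^sub>F \<epsilon> in at_right 0. (\<Sum>S\<in>UNIV. g S) * (LINT x|lborel. \<phi> x) \<le> 2 ^ CARD('d) * \<phi> 0 + \<epsilon> * (\<Sum>S\<in>UNIV. g S)"
    by (intro eventually_at_right_less[THEN eventually_mono] main)
  from tendsto_lowerbound[OF lim this] show ?thesis
    by simp
qed

lemma
  fixes F :: "'a::euclidean_space \<Rightarrow> real"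
  assumes "s > 0" and [measurable]: "F \<in> borel_measurable borel"
  shows lborel_integral_scaleR: "(LINT y|lborel. F (s *\<^sub>R y)) = (LINT x|lborel. F x) / s ^ DIM('a)"
    and lborel_integrable_scaleR: "integrable lborel F \<Longrightarrow> integrable lborel (\<lambda>y. F (s *\<^sub>R y))"
proof -
  have eq: "lborel = density (distr lborel borel (\<lambda>x::'a. s *\<^sub>R x)) (\<lambda>_. ennreal (s ^ DIM('a)))"
    using lborel_affine[of s "0 :: 'a"] \<open>s > 0\<close> by simp
  show "(LINT y|lborel. F (s *\<^sub>R y)) = (LINT x|lborel. F x) / s ^ DIM('a)"
    using \<open>s > 0\<close> by (subst (2) eq) (simp add: integral_density integral_distr)
  show "integrable lborel (\<lambda>y. F (s *\<^sub>R y))" if "integrable lborel F"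
    using that \<open>s > 0\<close> by (subst (asm) eq) (simp add: integrable_density integrable_distr_eq)
qed

text \<open>
Integrability is read off from the transform at the origin: the Bochner integral of a function that
is not integrable is \<open>0\<close> by convention, whereas feasibility makes it at least \<open>1\<close>.
\<close>
lemma feasible_integrable:
  assumes "f \<in> cohn_elkies_feasible r"
  shows "integrable lborel f"
proof (rule ccontr)
  assume "\<not> integrable lborel f"
  then have "fourier_transform f 0 = 0"
    by (simp add: fourier_transform_def not_integrable_integral_eq)
  with assms show False
    by (simp add: cohn_elkies_feasible_def less_eq_complex_def)
qed

lemma Re_fourier_transform:
  assumes "integrable lborel f"
  shows "Re (fourier_transform f \<xi>) = (LINT x|lborel. f x * cos (2 * pi * (x \<bullet> \<xi>)))"
proof -
  have phase: "exp (- 2 * of_real pi * \<i> * of_real (x \<bullet> \<xi>)) = cis (- (2 * pi * (x \<bullet> \<xi>)))" for x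
    by (simp add: cis_conv_exp mult_ac)
  have "continuous_on UNIV (\<lambda>x. cis (- (2 * pi * (x \<bullet> \<xi>))))"
    by (intro continuous_intros)
  then have meas: "(\<lambda>x. cis (- (2 * pi * (x \<bullet> \<xi>)))) \<in> borel_measurable lborel"
    by (simp add: borel_measurable_continuous_onI)
  have "integrable lborel (\<lambda>x. complex_of_real (f x) * cis (- (2 * pi * (x \<bullet> \<xi>))))"
    by (rule Bochner_Integration.integrable_bound[OF assms])
      (use assms meas in \<open>auto simp: norm_mult\<close>)
  from integral_Re[OF this] show ?thesis
    unfolding fourier_transform_def phase by simp
qed

text \<open>
Rescaling \<open>f\<close> by \<open>r / 2\<close> reduces to radius \<open>2\<close>. The Fourier coefficients needed there are values of the
transform of \<open>f\<close> at the points \<open>m / r\<close> with \<open>m\<close> an integer vector.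
\<close>
theorem cohn_elkies_bound_ge_code_dual:
  fixes g :: "'d::finite set \<Rightarrow> real"
  assumes "r > 0"
    and "\<And>S. 0 \<le> g S" and "g {} = 1"
    and "\<And>S. S \<noteq> {} \<Longrightarrow> card S < 4 \<Longrightarrow> g S = 0"
    and "\<And>\<epsilon>::'d \<Rightarrow> real. (\<And>i. \<epsilon> i = 1 \<or> \<epsilon> i = - 1) \<Longrightarrow> 0 \<le> (\<Sum>S\<in>UNIV. g S * (\<Prod>i\<in>S. \<epsilon> i))"
  shows "ereal ((\<Sum>S\<in>UNIV. g S) / 2 ^ CARD('d)) \<le> cohn_elkies_bound TYPE('d) r"
  unfolding cohn_elkies_bound_def
proof (intro INF_greatest)
  fix f :: "real^'d \<Rightarrow> real"
  assume f: "f \<in> cohn_elkies_feasible r"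
  define s where "s = r / 2"
  have s: "s > 0"
    using \<open>r > 0\<close> by (simp add: s_def)
  define \<phi> where "\<phi> y = f (s *\<^sub>R y)" for y
  note f_int = feasible_integrable[OF f]
  have "C_class 0 f"
    using f unfolding cohn_elkies_feasible_def smooth_def by blast
  then have f_cont: "continuous_on UNIV f"
    by simp
  then have f_meas [measurable]: "f \<in> borel_measurable borel"
    by (rule borel_measurable_continuous_onI)
  have cos_meas: "(\<lambda>x. cos (2 * pi * (x \<bullet> \<xi>))) \<in> borel_measurable borel" for \<xi> :: "real^'d"
    by (intro borel_measurable_continuous_onI continuous_intros)
  have fourier: "(LINT x|lborel. \<phi> x * cos (pi * (\<Sum>i\<in>UNIV. of_int (m i) * x $ i)))
      = Re (fourier_transform f (\<chi> i. of_int (m i) / (2 * s))) / s ^ CARD('d)" for m :: "'d \<Rightarrow> int"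
  proof -
    define \<xi> :: "real^'d" where "\<xi> = (\<chi> i. of_int (m i) / (2 * s))"
    have "pi * (\<Sum>i\<in>UNIV. of_int (m i) * x $ i) = 2 * pi * ((s *\<^sub>R x) \<bullet> \<xi>)" for x
      using s by (simp add: inner_vec_def \<xi>_def sum_distrib_left field_simps)
    then have "(LINT x|lborel. \<phi> x * cos (pi * (\<Sum>i\<in>UNIV. of_int (m i) * x $ i)))
        = (LINT x|lborel. (\<lambda>z. f z * cos (2 * pi * (z \<bullet> \<xi>))) (s *\<^sub>R x))"
      by (simp only: \<phi>_def)
    also have "\<dots> = Re (fourier_transform f \<xi>) / s ^ CARD('d)"
      using cos_meas[of \<xi>] by (subst lborel_integral_scaleR[OF s]) (simp_all add: Re_fourier_transform[OF f_int])
    finally show ?thesis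
      by (simp add: \<xi>_def)
  qed
  have "(\<Sum>S\<in>UNIV. g S) * (LINT x|lborel. \<phi> x) \<le> 2 ^ CARD('d) * \<phi> 0"
  proof (rule code_dual_bound)
    show "continuous_on UNIV \<phi>"
      unfolding \<phi>_def by (intro continuous_on_compose2[OF f_cont] continuous_intros) auto
    show "integrable lborel \<phi>"
      unfolding \<phi>_def[abs_def] by (rule lborel_integrable_scaleR[OF s f_meas f_int])
    show "0 \<le> \<phi> 0"
      using f by (simp add: \<phi>_def cohn_elkies_feasible_def)
    show "\<phi> x \<le> 0" if "2 \<le> norm x" for x
    proof -
      have "r \<le> norm (s *\<^sub>R x)"
        using that \<open>r > 0\<close> by (simp add: s_def)
      then show ?thesis
        using f by (simp add: \<phi>_def cohn_elkies_feasible_def)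
    qed
    show "0 \<le> (LINT x|lborel. \<phi> x * cos (pi * (\<Sum>i\<in>UNIV. of_int (m i) * x $ i)))" for m :: "'d \<Rightarrow> int"
      unfolding fourier using f s by (simp add: cohn_elkies_feasible_def less_eq_complex_def)
  qed (use assms in auto)
  moreover have "1 / s ^ CARD('d) \<le> (LINT x|lborel. \<phi> x)"
  proof -
    have "(\<chi> i. 0) = (0 :: real^'d)"
      by (simp add: vec_eq_iff)
    then have "(LINT x|lborel. \<phi> x) = Re (fourier_transform f 0) / s ^ CARD('d)"
      using fourier[of "\<lambda>_. 0"] by simp
    then show ?thesis
      using f s by (simp add: cohn_elkies_feasible_def less_eq_complex_def divide_right_mono)
  qed
  moreover have "0 \<le> (\<Sum>S\<in>UNIV. g S)"
    by (intro sum_nonneg assms)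
  ultimately have "(\<Sum>S\<in>UNIV. g S) * (1 / s ^ CARD('d)) \<le> 2 ^ CARD('d) * \<phi> 0"
    by (meson mult_left_mono order_trans)
  then have "(\<Sum>S\<in>UNIV. g S) / 2 ^ CARD('d) \<le> s ^ CARD('d) * f 0"
    using s by (simp add: \<phi>_def field_simps)
  then show "ereal ((\<Sum>S\<in>UNIV. g S) / 2 ^ CARD('d)) \<le> ereal ((r / 2) ^ CARD('d) * f 0)"
    by (simp add: s_def)
qed

section \<open>Delsarte weights for length nine and distance four\<close>

text \<open>
The character sum over words of weight \<open>w\<close> is an elementary symmetric polynomial in the signs, so the
generating function in \<open>w\<close> factors; with \<open>t\<close> minus signs its coefficients are the values of the
Krawtchouk polynomials at \<open>t\<close>.
\<close>
lemma coeff_prod_linear: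
  fixes \<epsilon> :: "'d::finite \<Rightarrow> real"
  shows "coeff (\<Prod>i\<in>UNIV. [:1, \<epsilon> i:]) w = (\<Sum>S | card S = w. \<Prod>i\<in>S. \<epsilon> i)"
proof -
  have "(\<Prod>i\<in>UNIV. [:1, \<epsilon> i:]) = (\<Prod>i\<in>UNIV. monom (\<epsilon> i) 1 + 1)"
    by (intro prod.cong refl) (simp add: monom_Suc monom_0 one_pCons)
  also have "\<dots> = (\<Sum>S\<in>UNIV. monom (\<Prod>i\<in>S. \<epsilon> i) (card S))"
  proof -
    have "(\<Prod>i\<in>S. monom (\<epsilon> i) 1) = monom (\<Prod>i\<in>S. \<epsilon> i) (card S)" for S :: "'d set"
      by (induction S rule: finite_induct[OF finite]) (auto simp: mult_monom monom_0 one_pCons)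
    then show ?thesis
      by (simp add: prod_add)
  qed
  finally show ?thesis
    by (simp add: coeff_sum sum.If_cases)
qed

lemma prod_linear_signs:
  fixes \<epsilon> :: "'d::finite \<Rightarrow> real"
  assumes "\<And>i. \<epsilon> i = 1 \<or> \<epsilon> i = - 1"
  obtains t where "t \<le> CARD('d)" "(\<Prod>i\<in>UNIV. [:1, \<epsilon> i:]) = [:1, -1:] ^ t * [:1, 1:] ^ (CARD('d) - t)"
proof (rule that)
  let ?T = "{i. \<epsilon> i = - 1}"
  show "card ?T \<le> CARD('d)"
    by (rule card_mono) auto
  have "(\<Prod>i\<in>UNIV. [:1, \<epsilon> i:]) = (\<Prod>i\<in>UNIV. if \<epsilon> i = - 1 then [:1, -1:] else [:1, 1:])"
    using assms by (intro prod.cong refl) auto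
  also have "\<dots> = [:1, -1:] ^ card ?T * [:1, 1:] ^ card (- ?T)"
    by (simp add: prod.If_cases Collect_neg_eq)
  finally show "(\<Prod>i\<in>UNIV. [:1, \<epsilon> i:]) = [:1, -1:] ^ card ?T * [:1, 1:] ^ (CARD('d) - card ?T)"
    by (simp add: Compl_eq_Diff_UNIV card_Diff_subset)
qed

text \<open>
The weight distribution \<open>18\<close>, \<open>24/5\<close>, \<open>9/5\<close> in weights \<open>4\<close>, \<open>6\<close>, \<open>8\<close>, divided by the numbers \<open>126\<close>, \<open>84\<close>, \<open>9\<close> of
words of these weights. The three values are determined by requiring the character sum to vanish
for one, two and three minus signs. Since only even weights occur, exchanging \<open>t\<close> and \<open>9 - t\<close> minus
signs does not change the sum, so it vanishes for six, seven and eight minus signs too.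
\<close>
definition delsarte9 :: "nat \<Rightarrow> real" where
  "delsarte9 w = (if w = 0 then 1 else if w = 4 then 1/7 else if w = 6 then 2/35 else if w = 8 then 1/5 else 0)"

lemma delsarte9_transform:
  fixes \<epsilon> :: "9 \<Rightarrow> real"
  shows "(\<Sum>S\<in>UNIV. delsarte9 (card S) * (\<Prod>i\<in>S. \<epsilon> i)) =
    (let P = \<Prod>i\<in>UNIV. [:1, \<epsilon> i:] in
     coeff P 0 + coeff P 4 / 7 + 2 * coeff P 6 / 35 + coeff P 8 / 5)"
proof -
  have "(\<Sum>S\<in>UNIV. delsarte9 (card S) * (\<Prod>i\<in>S. \<epsilon> i)) =
     (\<Sum>S\<in>UNIV. (if card S = 0 then \<Prod>i\<in>S. \<epsilon> i else 0) + (if card S = 4 then \<Prod>i\<in>S. \<epsilon> i else 0) / 7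
      + 2 * (if card S = 6 then \<Prod>i\<in>S. \<epsilon> i else 0) / 35 + (if card S = 8 then \<Prod>i\<in>S. \<epsilon> i else 0) / 5)"
    by (intro sum.cong refl) (simp add: delsarte9_def)
  then show ?thesis
    unfolding Let_def coeff_prod_linear
    by (simp only: sum.distrib flip: sum_divide_distrib sum_distrib_left)
      (simp add: sum.If_cases)
qed

lemma delsarte9_dual_feasible:
  fixes \<epsilon> :: "9 \<Rightarrow> real"
  assumes "\<And>i. \<epsilon> i = 1 \<or> \<epsilon> i = - 1"
  shows "0 \<le> (\<Sum>S\<in>UNIV. delsarte9 (card S) * (\<Prod>i\<in>S. \<epsilon> i))"
proof -
  obtain t where t: "t \<le> 9" "(\<Prod>i\<in>UNIV. [:1, \<epsilon> i:]) = [:1, -1:] ^ t * [:1, 1:] ^ (9 - t)"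
    using prod_linear_signs[of \<epsilon>] assms by auto
  from t(1) have "t \<in> {0, 1, 2, 3, 4, 5, 6, 7, 8, 9}"
    by auto
  then show ?thesis
    unfolding delsarte9_transform t(2) Let_def
    by (elim insertE emptyE) (simp_all add: numeral_eq_Suc)
qed

text \<open>
The total mass is the character sum for the trivial character.
\<close>
lemma sum_delsarte9: "(\<Sum>S\<in>UNIV. delsarte9 (card (S :: 9 set))) = 128 / 5"
  using delsarte9_transform[of "\<lambda>_. 1"] by (simp add: Let_def numeral_eq_Suc)

theorem theorem8p3:
  fixes r :: real
  assumes "r > 0"
  shows "cohn_elkies_bound TYPE(9) r \<ge> ereal (1 / 20)"
proof -
  have "ereal ((\<Sum>S\<in>UNIV. delsarte9 (card (S :: 9 set))) / 2 ^ CARD(9)) \<le> cohn_elkies_bound TYPE(9) r"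
    using assms
  proof (rule cohn_elkies_bound_ge_code_dual)
    show "delsarte9 (card S) = 0" if "S \<noteq> {}" "card S < 4" for S :: "9 set"
      using that by (simp add: delsarte9_def)
    show "0 \<le> delsarte9 (card S)" "delsarte9 (card ({} :: 9 set)) = 1" for S :: "9 set"
      by (simp_all add: delsarte9_def)
  qed (rule delsarte9_dual_feasible)
  then show ?thesis
    by (simp add: sum_delsarte9)
qed

end
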